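(* Let $n\ge 1$, $T>0$, and let $u_0:\mathbf{R}^n\to\mathbf{R}$ be Lipschitz continuous. Let $H_1:\mathbf{R}^n\times[0,T]\times\mathbf{R}^n\to\mathbf{R}$ be continuous and such that: $H_1(x,t,\lambda p)=\lambda H_1(x,t,p)$ for all $\lambda>0$ and all $(x,t,p)$; there is $L_1>0$ with $|H_1(x,t,p)-H_1(y,t,p)|\le L_1|x-y|$ for all $x,y\in\mathbf{R}^n$, $t\in[0,T]$, $|p|=1$; there is $L_2>0$ with $|H_1(x,t,p)-H_1(x,t,q)|\le L_2|p-q|$ for all $x,p,q\in\mathbf{R}^n$, $t\in[0,T]$; and $\sup\{|H_1(x,t,p)| : x\in\mathbf{R}^n,\ t\in[0,T],\ |p|=1\}<\infty$. Let $w$ be the viscosity solution of $w_t=H_1(x,t,\nabla w)$ in $\mathbf{R}^n\times(0,T)$, $w(\cdot,0)=u_0$. Assume $w\ge0$ everywhere, put $\Gamma_t=\{x:w(x,t)=0\}$, assume $\Gamma_t\neq\emptyset$ for all $t\in[0,T)$, and let $d(x,t)=\mathrm{dist}(x,\Gamma_t)\ge 0$ for $(x,t)\in\mathbf{R}^n\times(0,T)$. Then: (1) $d$ is lower semicontinuous in $\mathbf{R}^n\times(0,T)$. (2) $d$ is continuous from below in time, i.e. $d(x,t)=\lim_{(y,s)\to(x,t),\ s\le t}d(y,s)$ for all $(x,t)\in\mathbf{R}^n\times(0,T)$. (3) For every $(x,t)\in\mathbf{R}^n\times(0,T)$, $d$ is continuous at $(x,t)$ (as a function of space and time) if and only if $N_t(x)\setminus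 E_t\neq\emptyset$, where $N_t(x)=\{z\in\Gamma_t: d(x,t)=|x-z|\}$ is the set of nearest points of $\Gamma_t$ to $x$ and $E_t$ is the set of extinction points at time $t$.
   Context: Let $D=\{(x,t)\in\mathbf{R}^n\times(0,T): w(x,t)>0\}$. A point $x\in\Gamma_t$ is an extinction point (at time $t\in(0,T)$) if there exist $\varepsilon,\delta>0$ such that $\overline{B_\varepsilon(x)}\times(t,t+\delta]\subset D$. $\mathrm{dist}(x,\Omega)=\inf_{y\in\Omega}|x-y|$. Viscosity solutions of $u_t=F(x,t,\nabla u)$ with $F$ continuous: $u$ is a subsolution if $\phi_t\le F(x_0,t_0,\nabla\phi)$ at $(x_0,t_0)$ whenever $\phi\in C^1$ touches $u^*$ from above at $(x_0,t_0)\in\mathbf{R}^n\times(0,T)$; a supersolution if $\phi_t\ge F$ whenever $\phi$ touches $u_*$ from below; a solution if both. "The viscosity solution" of the initial value problem is the unique one that is continuous on $\mathbf{R}^n\times[0,T)$, attains the initial datum, and satisfies $u_0(x)-Kt\le w(x,t)\le u_0(x)+Kt$ for some $K>0$. *)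

theory Defs
  imports "HOL-Analysis.Analysis"
begin

text \<open>
  Space-time points are pairs \<open>(x, t)\<close> with \<open>x \<in> real ^ 'n\<close>.  The gradient of a test function with
  respect to the inner product of \<open>(real ^ 'n) \<times> real\<close> is the pair of its spatial gradient and its
  time derivative.
\<close>

definition slab :: "real \<Rightarrow> ((real ^ 'n) \<times> real) set" where
  "slab T = UNIV \<times> {0<..<T}"

definition C1_gradient_on ::
  "'a::real_inner set \<Rightarrow> ('a \<Rightarrow> real) \<Rightarrow> ('a \<Rightarrow> 'a) \<Rightarrow> bool" where
  "C1_gradient_on S \<phi> D\<phi> \<longleftrightarrow> (\<forall>z\<in>S. GDERIV \<phi> z :> D\<phi> z) \<and> continuous_on S D\<phi>"

text \<open>
  The filter below contains the point itself, in contrast to \<open>at z within S\<close>, so that the envelopes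
  satisfy \<open>lsc_envelope S u z \<le> u z \<le> usc_envelope S u z\<close> for \<open>z \<in> S\<close>.  They are extended-real
  valued because \<open>u\<close> need not be locally bounded.
\<close>

definition usc_envelope :: "'a::topological_space set \<Rightarrow> ('a \<Rightarrow> real) \<Rightarrow> 'a \<Rightarrow> ereal" where
  "usc_envelope S u z = Limsup (inf (nhds z) (principal S)) (\<lambda>y. ereal (u y))"

definition lsc_envelope :: "'a::topological_space set \<Rightarrow> ('a \<Rightarrow> real) \<Rightarrow> 'a \<Rightarrow> ereal" where
  "lsc_envelope S u z = Liminf (inf (nhds z) (principal S)) (\<lambda>y. ereal (u y))"

text \<open>
  Touching is understood locally: equality at the point and an inequality in a neighbourhood of it.
\<close>

definition touches_from_above ::
  "('a::topological_space \<Rightarrow> real) \<Rightarrow> ('a \<Rightarrow> ereal) \<Rightarrow> 'a \<Rightarrow> bool" where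
  "touches_from_above \<phi> v z \<longleftrightarrow> v z = ereal (\<phi> z) \<and> (\<forall>\<^sub>F y in nhds z. v y \<le> ereal (\<phi> y))"

definition touches_from_below ::
  "('a::topological_space \<Rightarrow> real) \<Rightarrow> ('a \<Rightarrow> ereal) \<Rightarrow> 'a \<Rightarrow> bool" where
  "touches_from_below \<phi> v z \<longleftrightarrow> v z = ereal (\<phi> z) \<and> (\<forall>\<^sub>F y in nhds z. ereal (\<phi> y) \<le> v y)"

text \<open>Viscosity sub- and supersolutions of \<open>u\<^sub>t = F(x, t, \<nabla>u)\<close> in \<open>slab T\<close>.\<close>

definition viscosity_subsolution ::
  "real \<Rightarrow> (real ^ 'n \<Rightarrow> real \<Rightarrow> real ^ 'n \<Rightarrow> real) \<Rightarrow> ((real ^ 'n) \<times> real \<Rightarrow> real) \<Rightarrow> bool" where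
  "viscosity_subsolution T F u \<longleftrightarrow>
     (\<forall>\<phi> D\<phi> x t. C1_gradient_on (slab T) \<phi> D\<phi> \<longrightarrow> (x, t) \<in> slab T \<longrightarrow>
        touches_from_above \<phi> (usc_envelope (slab T) u) (x, t) \<longrightarrow>
        snd (D\<phi> (x, t)) \<le> F x t (fst (D\<phi> (x, t))))"

definition viscosity_supersolution ::
  "real \<Rightarrow> (real ^ 'n \<Rightarrow> real \<Rightarrow> real ^ 'n \<Rightarrow> real) \<Rightarrow> ((real ^ 'n) \<times> real \<Rightarrow> real) \<Rightarrow> bool" where
  "viscosity_supersolution T F u \<longleftrightarrow>
     (\<forall>\<phi> D\<phi> x t. C1_gradient_on (slab T) \<phi> D\<phi> \<longrightarrow> (x, t) \<in> slab T \<longrightarrow>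
        touches_from_below \<phi> (lsc_envelope (slab T) u) (x, t) \<longrightarrow>
        snd (D\<phi> (x, t)) \<ge> F x t (fst (D\<phi> (x, t))))"

definition viscosity_solution ::
  "real \<Rightarrow> (real ^ 'n \<Rightarrow> real \<Rightarrow> real ^ 'n \<Rightarrow> real) \<Rightarrow> ((real ^ 'n) \<times> real \<Rightarrow> real) \<Rightarrow> bool" where
  "viscosity_solution T F u \<longleftrightarrow> viscosity_subsolution T F u \<and> viscosity_supersolution T F u"

text \<open>
  The viscosity solution of the initial value problem, characterised by the properties that single it
  out; only the values of \<open>w\<close> at times in \<open>{0..<T}\<close> are relevant.
\<close>

definition viscosity_solution_ivp ::
  "real \<Rightarrow> (real ^ 'n \<Rightarrow> real \<Rightarrow> real ^ 'n \<Rightarrow> real) \<Rightarrow> (real ^ 'n \<Rightarrow> real)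
     \<Rightarrow> ((real ^ 'n) \<times> real \<Rightarrow> real) \<Rightarrow> bool" where
  "viscosity_solution_ivp T F u0 w \<longleftrightarrow>
     viscosity_solution T F w \<and>
     continuous_on (UNIV \<times> {0..<T}) w \<and>
     (\<forall>x. w (x, 0) = u0 x) \<and>
     (\<exists>K>0. \<forall>x. \<forall>t\<in>{0..<T}. u0 x - K * t \<le> w (x, t) \<and> w (x, t) \<le> u0 x + K * t)"

definition zero_level :: "((real ^ 'n) \<times> real \<Rightarrow> real) \<Rightarrow> real \<Rightarrow> (real ^ 'n) set" where
  "zero_level w t = {x. w (x, t) = 0}"

definition positive_region :: "real \<Rightarrow> ((real ^ 'n) \<times> real \<Rightarrow> real) \<Rightarrow> ((real ^ 'n) \<times> real) set" where
  "positive_region T w = {z \<in> slab T. w z > 0}"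

definition extinction_points :: "real \<Rightarrow> ((real ^ 'n) \<times> real \<Rightarrow> real) \<Rightarrow> real \<Rightarrow> (real ^ 'n) set" where
  "extinction_points T w t =
     {x \<in> zero_level w t. \<exists>\<epsilon>>0. \<exists>\<delta>>0. cball x \<epsilon> \<times> {t<..t + \<delta>} \<subseteq> positive_region T w}"

text \<open>The library's \<open>infdist x A\<close> is the infimum of \<open>dist x y\<close> over \<open>y \<in> A\<close> for nonempty \<open>A\<close>.\<close>

definition level_dist :: "((real ^ 'n) \<times> real \<Rightarrow> real) \<Rightarrow> (real ^ 'n) \<times> real \<Rightarrow> real" where
  "level_dist w = (\<lambda>(x, t). infdist x (zero_level w t))"

definition nearest_points ::
  "((real ^ 'n) \<times> real \<Rightarrow> real) \<Rightarrow> real \<Rightarrow> real ^ 'n \<Rightarrow> (real ^ 'n) set" where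
  "nearest_points w t x = {z \<in> zero_level w t. level_dist w (x, t) = norm (x - z)}"

definition lower_semicontinuous_on :: "'a::topological_space set \<Rightarrow> ('a \<Rightarrow> real) \<Rightarrow> bool" where
  "lower_semicontinuous_on S f \<longleftrightarrow> (\<forall>z\<in>S. \<forall>c<f z. \<forall>\<^sub>F y in at z within S. c < f y)"

end

theory Submission
  imports Defs
begin

text \<open>
  Homogeneity and boundedness give \<open>|H\<^sub>1(x, t, p)| \<le> M |p|\<close>, so a paraboloid barrier shows that
  positivity of \<open>w\<close> on a small ball at time \<open>s\<close> forces positivity at its centre for a short time
  after \<open>s\<close>.  Equivalently, near every zero at time \<open>t\<close> there are zeros at all times slightly before
  \<open>t\<close>.  This gives continuity from below in time.  A nearest point that is not an extinction point
  is approximated by zeros at some slightly later time, and following these backwards yields zeros at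
  all intermediate times.  The remaining claims are compactness arguments: limits of zeros are zeros.
\<close>

section \<open>Envelopes, growth of the Hamiltonian, and the barrier's gradient\<close>

text \<open>On an open set the filter in the envelope is the full neighbourhood filter, so
  continuity determines the value. The supersolution test can then be applied to \<open>w\<close>
  itself.\<close>

lemma lsc_envelope_eq:
  fixes u :: "'a::t2_space \<Rightarrow> real"
  assumes "open S" "z \<in> S" "continuous_on S u"
  shows "lsc_envelope S u z = ereal (u z)"
proof -
  have "\<forall>\<^sub>F y in nhds z. y \<in> S"
    using assms by (simp add: eventually_nhds_in_open)
  then have "inf (nhds z) (principal S) = nhds z"
    by (simp add: inf_absorb1 le_principal)
  moreover have "(u \<longlongrightarrow> u z) (nhds z)"
    using assms
    using continuous_on_eq_continuous_at[of S u] tendsto_at_iff_tendsto_nhds[of u z]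
    by (simp add: isCont_def)
  then have "((\<lambda>y. ereal (u y)) \<longlongrightarrow> ereal (u z)) (nhds z)"
    by simp
  ultimately show ?thesis
    unfolding lsc_envelope_def by (simp add: lim_imp_Liminf nhds_neq_bot)
qed

lemma open_slab: "open (slab T)"
  unfolding slab_def by (intro open_Times) auto

text \<open>Rescaling to the unit sphere handles \<open>p \<noteq> 0\<close>; at the origin,
  \<open>h 0 = 2 * h 0\<close> forces \<open>h 0 = 0\<close>.\<close>

lemma positively_homogeneous_bounded:
  fixes h :: "'a::real_normed_vector \<Rightarrow> real"
  assumes hom: "\<And>r p. r > 0 \<Longrightarrow> h (r *\<^sub>R p) = r * h p"
    and bound: "\<And>p. norm p = 1 \<Longrightarrow> \<bar>h p\<bar> \<le> M"
  shows "\<bar>h p\<bar> \<le> M * norm p"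
proof (cases "p = 0")
  case True
  then show ?thesis using hom[of 2 0] by simp
next
  case False
  then have "h p = norm p * h (p /\<^sub>R norm p)"
    using hom[of "norm p" "p /\<^sub>R norm p"] by simp
  moreover have "\<bar>h (p /\<^sub>R norm p)\<bar> \<le> M"
    using False by (intro bound) simp
  ultimately show ?thesis
    by (simp add: abs_mult mult.commute[of M] mult_left_mono)
qed

text \<open>The free constant \<open>m\<close> allows the paraboloid to be shifted vertically until
  it touches \<open>w\<close>.\<close>

lemma paraboloid_C1_gradient_on:
  fixes z :: "'a::real_inner" and m c k :: real
  shows "C1_gradient_on S (\<lambda>(y, \<tau>). m - c * ((y - z) \<bullet> (y - z)) - k * \<tau>)
    (\<lambda>(y, \<tau>). (- (2 * c) *\<^sub>R (y - z), - k))"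
proof -
  have "GDERIV (\<lambda>q. m - c * ((fst q - z) \<bullet> (fst q - z)) - k * snd q) (y, \<tau>)
      :> (- (2 * c) *\<^sub>R (y - z), - k)" for y \<tau>
    unfolding gderiv_def
    by (auto intro!: derivative_eq_intros
        simp: fun_eq_iff inner_commute inner_diff_left inner_diff_right algebra_simps)
  then show ?thesis
    unfolding C1_gradient_on_def by (auto simp: case_prod_unfold intro!: continuous_intros)
qed

section \<open>Propagation of positivity and zeros at earlier times\<close>

text \<open>
  The paraboloid \<open>c (\<rho>\<^sup>2 - |y - z|\<^sup>2 - k (\<tau> - s))\<close> is a strict subsolution as long as it is positive,
  and at time \<open>s + \<rho>\<^sup>2 / k\<close> it is nonpositive everywhere.  Hence the minimum of the difference to the
  nonnegative function \<open>w\<close>, if negative, is not attained at the final time.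
\<close>

lemma positive_propagates:
  fixes w :: "(real ^ 'n) \<times> real \<Rightarrow> real"
  assumes super: "viscosity_supersolution T F w"
    and cont: "continuous_on (UNIV \<times> {0..<T}) w"
    and nonneg: "\<And>x t. t \<in> {0..<T} \<Longrightarrow> w (x, t) \<ge> 0"
    and bound: "\<And>x t p. t \<in> {0..T} \<Longrightarrow> \<bar>F x t p\<bar> \<le> M * norm p"
    and "M \<ge> 0" "0 \<le> s" "\<rho> > 0" "k > 2 * M * \<rho>" "s + \<rho>\<^sup>2 / k < T"
    and pos: "\<And>y. y \<in> cball z \<rho> \<Longrightarrow> w (y, s) > 0"
    and t: "s \<le> t" "t < s + \<rho>\<^sup>2 / k"
  shows "w (z, t) > 0"
proof -
  \<comment> \<open>At time \<open>b\<close> the peak of the barrier, located at \<open>z\<close>,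
    has dropped to height zero.\<close>
  define b where "b = s + \<rho>\<^sup>2 / k"
  have "k > 0"
    using assms by (smt (verit) mult_nonneg_nonneg)
  then have "s < b" and kb: "k * (b - s) = \<rho>\<^sup>2"
    using \<open>\<rho> > 0\<close> by (auto simp: b_def)
  have cont': "continuous_on (cball z \<rho> \<times> {s..b}) w"
    using assms by (intro continuous_on_subset[OF cont]) (auto simp: b_def)
  have "continuous_on (cball z \<rho>) (\<lambda>y. w (y, s))"
    using \<open>s < b\<close> by (intro continuous_on_compose2[OF cont'] continuous_intros) auto
  then obtain y0 where y0: "y0 \<in> cball z \<rho>" "\<And>y. y \<in> cball z \<rho> \<Longrightarrow> w (y0, s) \<le> w (y, s)"
    using continuous_attains_inf[of "cball z \<rho>" "\<lambda>y. w (y, s)"] \<open>\<rho> > 0\<close> by auto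
  \<comment> \<open>With this scale the initial peak \<open>c * \<rho>\<^sup>2\<close> equals the
    minimum of \<open>w\<close> over the ball at time \<open>s\<close>, so the barrier starts below
    \<open>w\<close>.\<close>
  define c where "c = w (y0, s) / \<rho>\<^sup>2"
  have "c > 0" and c\<rho>: "c * \<rho>\<^sup>2 = w (y0, s)"
    using pos[OF y0(1)] \<open>\<rho> > 0\<close> by (auto simp: c_def)
  define \<phi> where "\<phi> = (\<lambda>(y, \<tau>). c * (\<rho>\<^sup>2 - (y - z) \<bullet> (y - z) - k * (\<tau> - s)))"
  have "continuous_on (cball z \<rho> \<times> {s..b}) (\<lambda>q. w q - \<phi> q)"
    unfolding \<phi>_def case_prod_unfold by (intro continuous_intros cont')
  moreover have "compact (cball z \<rho> \<times> {s..b})" "cball z \<rho> \<times> {s..b} \<noteq> {}"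
    using \<open>\<rho> > 0\<close> \<open>s < b\<close> by (auto simp: compact_Times)
  ultimately obtain y \<tau> where y: "y \<in> cball z \<rho>" and \<tau>: "\<tau> \<in> {s..b}"
    and min: "\<And>q. q \<in> cball z \<rho> \<times> {s..b} \<Longrightarrow> w (y, \<tau>) - \<phi> (y, \<tau>) \<le> w q - \<phi> q"
    using continuous_attains_inf[of "cball z \<rho> \<times> {s..b}" "\<lambda>q. w q - \<phi> q"] by auto
  have "\<phi> (y, \<tau>) \<le> w (y, \<tau>)"
  proof (rule ccontr)
    assume neg: "\<not> \<phi> (y, \<tau>) \<le> w (y, \<tau>)"
    have \<tau>T: "\<tau> \<in> {0..<T}"
      using \<tau> assms by (auto simp: b_def)
    have inner_eq: "(y - z) \<bullet> (y - z) = (dist z y)\<^sup>2"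
      by (simp add: dist_norm norm_minus_commute power2_norm_eq_inner)
    \<comment> \<open>Since \<open>\<phi> > w \<ge> 0\<close> at the minimum point, that point lies
      strictly inside the ball and strictly before \<open>b\<close>, where the barrier is
      positive.\<close>
    have "\<phi> (y, \<tau>) > 0"
      using neg nonneg[OF \<tau>T, of y] by simp
    then have "(dist z y)\<^sup>2 + k * (\<tau> - s) < \<rho>\<^sup>2"
      using \<open>c > 0\<close> by (simp add: \<phi>_def inner_eq zero_less_mult_iff)
    moreover have "k * (\<tau> - s) \<ge> 0"
      using \<tau> \<open>k > 0\<close> by simp
    ultimately have "(dist z y)\<^sup>2 < \<rho>\<^sup>2" "k * (\<tau> - s) < k * (b - s)"
      unfolding kb by (smt (verit) zero_le_power2)+
    then have y': "dist z y < \<rho>" and "\<tau> < b"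
      using \<open>\<rho> > 0\<close> \<open>k > 0\<close> by (auto intro: power2_less_imp_less)
    \<comment> \<open>The choice of \<open>c\<close> rules out a negative minimum at the initial
      time.\<close>
    have "\<phi> (y, s) \<le> c * \<rho>\<^sup>2"
      using \<open>c > 0\<close> by (simp add: \<phi>_def)
    then have "\<tau> \<noteq> s"
      using neg y0(2)[OF y] c\<rho> by auto
    then have "\<tau> > s"
      using \<tau> by simp
    \<comment> \<open>This is \<open>\<phi>\<close> lowered by the size of the negative minimum,
      expanded into the shape of the gradient lemma, so that it touches \<open>w\<close> at
      \<open>(y, \<tau>)\<close>.\<close>
    define \<psi> where "\<psi> = (\<lambda>(y', \<tau>'). (c * \<rho>\<^sup>2 + c * k * s + w (y, \<tau>) - \<phi> (y, \<tau>))
      - c * ((y' - z) \<bullet> (y' - z)) - c * k * \<tau>')"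
    have \<psi>: "\<psi> q = \<phi> q + (w (y, \<tau>) - \<phi> (y, \<tau>))" for q
      by (cases q) (simp add: \<psi>_def \<phi>_def algebra_simps)
    have "open (ball z \<rho> \<times> {s<..<b})" "(y, \<tau>) \<in> ball z \<rho> \<times> {s<..<b}"
      using y' \<open>\<tau> > s\<close> \<open>\<tau> < b\<close> by (auto simp: open_Times)
    then have ev: "\<forall>\<^sub>F q in nhds (y, \<tau>). q \<in> ball z \<rho> \<times> {s<..<b}"
      by (rule eventually_nhds_in_open)
    have env: "lsc_envelope (slab T) w q = ereal (w q)" if "q \<in> slab T" for q
      using that by (intro lsc_envelope_eq open_slab continuous_on_subset[OF cont])
        (auto simp: slab_def)
    have "touches_from_below \<psi> (lsc_envelope (slab T) w) (y, \<tau>)"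
      unfolding touches_from_below_def
    proof
      show "lsc_envelope (slab T) w (y, \<tau>) = ereal (\<psi> (y, \<tau>))"
        using \<tau>T \<open>\<tau> > s\<close> \<open>0 \<le> s\<close> by (subst env) (auto simp: slab_def \<psi>)
      show "\<forall>\<^sub>F q in nhds (y, \<tau>). ereal (\<psi> q) \<le> lsc_envelope (slab T) w q"
        using ev
      proof eventually_elim
        case (elim q)
        then have "q \<in> slab T" "q \<in> cball z \<rho> \<times> {s..b}"
          using assms by (auto simp: slab_def b_def)
        then show ?case
          using min[of q] by (simp add: env \<psi>)
      qed
    qed
    moreover have "(y, \<tau>) \<in> slab T"
      using \<tau>T \<open>\<tau> > s\<close> \<open>0 \<le> s\<close> by (auto simp: slab_def)
    \<comment> \<open>The supersolution test bounds \<open>F\<close> above by the time slope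
      \<open>- (c * k)\<close>, whereas the growth bound only permits
      \<open>F \<ge> - (2 * c * M * \<rho>)\<close>. The condition on \<open>k\<close> makes these
      incompatible.\<close>
    ultimately have "F y \<tau> (- (2 * c) *\<^sub>R (y - z)) \<le> - (c * k)"
      using super paraboloid_C1_gradient_on[of "slab T" _ c z "c * k"]
      unfolding viscosity_supersolution_def \<psi>_def by fastforce
    moreover have "\<bar>F y \<tau> (- (2 * c) *\<^sub>R (y - z))\<bar> \<le> M * (2 * c * dist z y)"
      using bound[of \<tau> y "- (2 * c) *\<^sub>R (y - z)"] \<tau>T \<open>c > 0\<close>
      by (simp add: dist_norm norm_minus_commute)
    moreover have "M * (2 * c * dist z y) \<le> M * (2 * c * \<rho>)"
      using y' \<open>c > 0\<close> \<open>M \<ge> 0\<close> by (intro mult_left_mono) auto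
    moreover have "c * (2 * M * \<rho>) < c * k"
      using \<open>c > 0\<close> assms by simp
    ultimately show False
      by (simp add: algebra_simps)
  qed
  moreover have "(z, t) \<in> cball z \<rho> \<times> {s..b}"
    using t \<open>\<rho> > 0\<close> by (auto simp: b_def)
  ultimately have "\<phi> (z, t) \<le> w (z, t)"
    using min[of "(z, t)"] by simp
  \<comment> \<open>At the centre the barrier has height \<open>c * k * (b - t)\<close>, which is
    positive before \<open>b\<close>.\<close>
  moreover have "k * (t - s) < k * (b - s)"
    using t \<open>k > 0\<close> unfolding b_def by (intro mult_strict_left_mono) auto
  then have "\<phi> (z, t) > 0"
    using \<open>c > 0\<close> by (simp add: \<phi>_def kb)
  ultimately show ?thesis
    by simp
qed

text \<open>Contrapositive of the propagation of positivity. The step \<open>\<eta>\<close> is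
  uniform in \<open>s\<close>, \<open>t\<close> and \<open>z\<close>; the bound \<open>t0\<close>
  keeps the barrier's lifetime inside the time interval.\<close>

lemma zero_level_backward:
  fixes w :: "(real ^ 'n) \<times> real \<Rightarrow> real"
  assumes super: "viscosity_supersolution T F w"
    and cont: "continuous_on (UNIV \<times> {0..<T}) w"
    and nonneg: "\<And>x t. t \<in> {0..<T} \<Longrightarrow> w (x, t) \<ge> 0"
    and bound: "\<And>x t p. t \<in> {0..T} \<Longrightarrow> \<bar>F x t p\<bar> \<le> M * norm p"
    and "M \<ge> 0" "\<epsilon> > 0" "t0 < T"
  shows "\<exists>\<eta>>0. \<forall>s t z. 0 \<le> s \<and> s \<le> t \<and> t < s + \<eta> \<and> t \<le> t0 \<and> z \<in> zero_level w t \<longrightarrow>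
    (\<exists>y \<in> zero_level w s. dist z y \<le> \<epsilon>)"
proof -
  \<comment> \<open>The first two summands make the barrier a strict subsolution with
    \<open>k > 0\<close>; the last one gives \<open>\<epsilon>\<^sup>2 / k < T - t0\<close>, so the
    barrier expires before \<open>T\<close>.\<close>
  define k where "k = 2 * M * \<epsilon> + 1 + \<epsilon>\<^sup>2 / (T - t0)"
  have "\<epsilon>\<^sup>2 / (T - t0) > 0" "2 * M * \<epsilon> \<ge> 0"
    using assms by auto
  then have k: "k > 2 * M * \<epsilon>" "k > 0" "\<epsilon>\<^sup>2 / (T - t0) < k"
    by (auto simp: k_def)
  then have "\<epsilon>\<^sup>2 / k < T - t0"
    using assms by (simp add: field_simps)
  have "\<exists>y \<in> zero_level w s. dist z y \<le> \<epsilon>"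
    if st: "0 \<le> s" "s \<le> t" "t < s + \<epsilon>\<^sup>2 / k" "t \<le> t0" and z: "z \<in> zero_level w t" for s t z
  proof (rule ccontr)
    assume *: "\<not> ?thesis"
    have "w (y, s) > 0" if "y \<in> cball z \<epsilon>" for y
    proof -
      have "w (y, s) \<noteq> 0"
        using * that by (auto simp: zero_level_def)
      then show ?thesis
        using nonneg[of s y] st \<open>t0 < T\<close> by auto
    qed
    then have "w (z, t) > 0"
      using positive_propagates[OF super cont nonneg bound \<open>M \<ge> 0\<close> \<open>0 \<le> s\<close> \<open>\<epsilon> > 0\<close> k(1), of z t]
        st \<open>\<epsilon>\<^sup>2 / k < T - t0\<close> by simp
    then show False
      using z by (simp add: zero_level_def)
  qed
  moreover have "\<epsilon>\<^sup>2 / k > 0"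
    using k \<open>\<epsilon> > 0\<close> by simp
  ultimately show ?thesis
    by blast
qed

section \<open>Limits of zeros, nearest points and lower semicontinuity\<close>

lemma zero_level_limit:
  assumes cont: "continuous_on (UNIV \<times> {0..<T}) w"
    and "t \<in> {0..<T}" "\<And>n. s n \<in> {0..<T}" "\<And>n. z n \<in> zero_level w (s n)"
    and "z \<longlonglongrightarrow> z0" "s \<longlonglongrightarrow> t"
  shows "z0 \<in> zero_level w t"
proof -
  have "(\<lambda>n. w (z n, s n)) \<longlonglongrightarrow> w (z0, t)"
    using assms by (intro continuous_on_tendsto_compose[OF cont] tendsto_Pair) auto
  then show ?thesis
    using assms(4) by (simp add: zero_level_def LIMSEQ_const_iff)
qed

lemma closed_zero_level:
  assumes "continuous_on (UNIV \<times> {0..<T}) w" "t \<in> {0..<T}"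
  shows "closed (zero_level w t)"
  unfolding closed_sequential_limits
  using zero_level_limit[OF assms, of "\<lambda>_. t"] assms(2) by auto

lemma nearest_points_nonempty:
  assumes "continuous_on (UNIV \<times> {0..<T}) w" "t \<in> {0..<T}" "zero_level w t \<noteq> {}"
  shows "nearest_points w t x \<noteq> {}"
  using infdist_attains_inf[OF closed_zero_level[OF assms(1,2)] assms(3), of x]
  by (auto simp: nearest_points_def level_dist_def dist_norm)

lemma level_dist_le: "z \<in> zero_level w t \<Longrightarrow> level_dist w (x, t) \<le> dist x z"
  by (simp add: level_dist_def infdist_le)

text \<open>If the distance stayed at most \<open>c\<close> along points converging to
  \<open>q\<close>, their nearest zeros would be bounded. A cluster point would then be a zero at
  the limiting time within distance \<open>c\<close>.\<close>

lemma lower_semicontinuous_on_level_dist: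
  fixes w :: "(real ^ 'n) \<times> real \<Rightarrow> real"
  assumes cont: "continuous_on (UNIV \<times> {0..<T}) w"
    and nonempty: "\<And>t. t \<in> {0..<T} \<Longrightarrow> zero_level w t \<noteq> {}"
  shows "lower_semicontinuous_on (slab T) (level_dist w)"
  unfolding lower_semicontinuous_on_def
proof (intro ballI allI impI)
  fix q :: "(real ^ 'n) \<times> real" and c
  assume q: "q \<in> slab T" and c: "c < level_dist w q"
  obtain x t where [simp]: "q = (x, t)" by force
  have tT: "t \<in> {0<..<T}"
    using q by (simp add: slab_def)
  show "\<forall>\<^sub>F y in at q within slab T. c < level_dist w y"
  proof (rule ccontr)
    assume *: "\<not> ?thesis"
    have "\<exists>p\<in>slab T. dist p q < inverse (Suc n) \<and> level_dist w p \<le> c" for n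
    proof -
      have "inverse (real (Suc n)) > 0"
        by simp
      then show ?thesis
        using * unfolding eventually_at not_ex not_all not_less by (meson not_less)
    qed
    then obtain p where p: "\<And>n. p n \<in> slab T" "\<And>n. dist (p n) q < inverse (Suc n)"
      "\<And>n. level_dist w (p n) \<le> c"
      by metis
    have "p \<longlonglongrightarrow> q"
      using p(2) by (intro metric_tendsto_imp_tendsto[OF LIMSEQ_inverse_real_of_nat, of p q])
        (auto intro!: always_eventually less_imp_le)
    then have lim: "(\<lambda>n. fst (p n)) \<longlonglongrightarrow> x" "(\<lambda>n. snd (p n)) \<longlonglongrightarrow> t"
      using tendsto_fst[of p q] tendsto_snd[of p q] by auto
    have s: "snd (p n) \<in> {0..<T}" for n
      using p(1)[of n] by (auto simp: slab_def)
    have "\<exists>z. z \<in> nearest_points w (snd (p n)) (fst (p n))" for n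
      using nearest_points_nonempty[OF cont s nonempty[OF s]] by blast
    then obtain z where "\<And>n. z n \<in> nearest_points w (snd (p n)) (fst (p n))"
      by metis
    then have z: "\<And>n. z n \<in> zero_level w (snd (p n))" "\<And>n. dist (fst (p n)) (z n) \<le> c"
      using p(3) by (auto simp: nearest_points_def dist_norm)
    have "bounded (range z)"
    proof -
      have "bounded (range (\<lambda>n. fst (p n)))"
        using lim(1) by (intro convergent_imp_bounded) auto
      then obtain a where a: "\<And>n. norm (fst (p n)) \<le> a"
        by (auto simp: bounded_iff)
      have "norm (z n) \<le> a + c" for n
        using a[of n] z(2)[of n] norm_triangle_ineq4[of "fst (p n)" "fst (p n) - z n"]
        by (simp add: dist_norm)
      then show ?thesis
        by (auto simp: bounded_iff)
    qed
    then obtain z0 r where r: "strict_mono r" "(z \<circ> r) \<longlonglongrightarrow> z0"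
      using bounded_imp_convergent_subsequence by blast
    have lim': "(\<lambda>n. fst (p (r n))) \<longlonglongrightarrow> x" "(\<lambda>n. snd (p (r n))) \<longlonglongrightarrow> t"
      using LIMSEQ_subseq_LIMSEQ[OF lim(1) r(1)] LIMSEQ_subseq_LIMSEQ[OF lim(2) r(1)]
      by (auto simp: o_def)
    have "z0 \<in> zero_level w t"
      using tT s z r(2) lim'(2)
      by (intro zero_level_limit[OF cont, of t "\<lambda>n. snd (p (r n))" "z \<circ> r"]) auto
    then have "level_dist w (x, t) \<le> dist x z0"
      by (rule level_dist_le)
    also have "dist x z0 \<le> c"
      using tendsto_dist[OF lim'(1) r(2)] z(2) by (intro LIMSEQ_le_const2) auto
    finally show False
      using c by simp
  qed
qed

section \<open>Continuity criteria for the distance\<close>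

text \<open>Lower semicontinuity supplies the lower bound, so only the upper bound needs zeros close
  to one fixed nearest point. The set \<open>S\<close> is left general to cover both past times and
  all times.\<close>

lemma level_dist_tendsto:
  fixes w :: "(real ^ 'n) \<times> real \<Rightarrow> real"
  assumes cont: "continuous_on (UNIV \<times> {0..<T}) w"
    and nonempty: "\<And>t. t \<in> {0..<T} \<Longrightarrow> zero_level w t \<noteq> {}"
    and "t \<in> {0<..<T}" "z \<in> nearest_points w t x" "S \<subseteq> slab T"
    and near: "\<And>\<epsilon>. \<epsilon> > 0 \<Longrightarrow>
      \<forall>\<^sub>F (y, s) in at (x, t) within S. \<exists>z' \<in> zero_level w s. dist z z' \<le> \<epsilon>"
  shows "(level_dist w \<longlongrightarrow> level_dist w (x, t)) (at (x, t) within S)"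
proof (rule order_tendstoI)
  fix c
  assume "c < level_dist w (x, t)"
  then have "\<forall>\<^sub>F q in at (x, t) within slab T. c < level_dist w q"
    using lower_semicontinuous_on_level_dist[OF cont nonempty] assms(3)
    by (auto simp: lower_semicontinuous_on_def slab_def)
  then show "\<forall>\<^sub>F q in at (x, t) within S. c < level_dist w q"
    using at_le[OF \<open>S \<subseteq> slab T\<close>] by (metis filter_leD)
next
  fix c
  assume c: "level_dist w (x, t) < c"
  \<comment> \<open>One half of the gap pays for moving from \<open>x\<close> to \<open>y\<close>,
    the other for moving from \<open>z\<close> to \<open>z'\<close>.\<close>
  define \<epsilon> where "\<epsilon> = (c - level_dist w (x, t)) / 2"
  have "\<epsilon> > 0"
    using c by (simp add: \<epsilon>_def)
  have "\<forall>\<^sub>F q in at (x, t) within S. dist q (x, t) < \<epsilon>"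
    using \<open>\<epsilon> > 0\<close> unfolding eventually_at by auto
  with near[OF \<open>\<epsilon> > 0\<close>] show "\<forall>\<^sub>F q in at (x, t) within S. level_dist w q < c"
  proof eventually_elim
    case (elim q)
    obtain y s where [simp]: "q = (y, s)" by force
    obtain z' where z': "z' \<in> zero_level w s" "dist z z' \<le> \<epsilon>"
      using elim by auto
    have "dist y x < \<epsilon>"
      using elim dist_fst_le[of q "(x, t)"] by simp
    moreover have "dist x z = level_dist w (x, t)"
      using assms(4) by (simp add: nearest_points_def dist_norm)
    moreover have "dist y z' \<le> dist y x + dist x z + dist z z'"
      by (smt (verit) dist_triangle)
    ultimately have "dist y z' < c"
      using z'(2) by (simp add: \<epsilon>_def field_simps)
    then show ?case
      using level_dist_le[OF z'(1), of y] by simp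
  qed
qed

text \<open>Nearest points at times decreasing to \<open>t\<close> accumulate at a zero. Continuity
  of the distance makes it a nearest point at time \<open>t\<close>, and being a limit of later
  zeros it cannot be an extinction point.\<close>

lemma nearest_point_not_extinction_point:
  fixes w :: "(real ^ 'n) \<times> real \<Rightarrow> real"
  assumes cont: "continuous_on (UNIV \<times> {0..<T}) w"
    and nonempty: "\<And>t. t \<in> {0..<T} \<Longrightarrow> zero_level w t \<noteq> {}"
    and t: "t \<in> {0<..<T}"
    and d: "continuous (at (x, t) within slab T) (level_dist w)"
  shows "nearest_points w t x - extinction_points T w t \<noteq> {}"
proof -
  \<comment> \<open>The double \<open>Suc\<close> keeps the factor at most \<open>1/2\<close>, so
    that already the first time is below \<open>T\<close>.\<close>
  define s where "s = (\<lambda>n. t + (T - t) * inverse (real (Suc (Suc n))))"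
  have s: "s n \<in> {0..<T}" "s n > t" for n
  proof -
    have "(T - t) * inverse (real (Suc (Suc n))) < (T - t) * 1"
      using t by (intro mult_strict_left_mono) (auto intro!: inverse_less_1_iff[THEN iffD2])
    moreover have "(T - t) * inverse (real (Suc (Suc n))) > 0"
      using t by simp
    ultimately
    show "s n \<in> {0..<T}" "s n > t"
      using t by (auto simp: s_def)
  qed
  have "s \<longlonglongrightarrow> t"
    unfolding s_def
    using tendsto_add[OF tendsto_const tendsto_mult_right_zero[OF
          LIMSEQ_Suc[OF LIMSEQ_inverse_real_of_nat]], of t "T - t"] by simp
  then have "(\<lambda>n. (x, s n)) \<longlonglongrightarrow> (x, t)"
    by (intro tendsto_intros)
  moreover have "(x, s n) \<in> slab T \<and> (x, s n) \<noteq> (x, t)" for n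
    using s[of n] t by (auto simp: slab_def)
  ultimately have "filterlim (\<lambda>n. (x, s n)) (at (x, t) within slab T) sequentially"
    by (simp add: filterlim_at)
  with d have lim: "(\<lambda>n. level_dist w (x, s n)) \<longlonglongrightarrow> level_dist w (x, t)"
    unfolding continuous_within by (rule filterlim_compose)
  have "\<exists>z. z \<in> nearest_points w (s n) x" for n
    using nearest_points_nonempty[OF cont s(1) nonempty[OF s(1)]] by blast
  then obtain z where "\<And>n. z n \<in> nearest_points w (s n) x"
    by metis
  then have z: "\<And>n. z n \<in> zero_level w (s n)" "\<And>n. dist x (z n) = level_dist w (x, s n)"
    by (auto simp: nearest_points_def dist_norm)
  have "bounded (range (\<lambda>n. dist x (z n)))"
    using lim z(2) by (intro convergent_imp_bounded) auto
  then obtain a where "\<And>n. dist x (z n) \<le> a"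
    by (auto simp: bounded_iff)
  then have "bounded (range z)"
    unfolding bounded_def by auto
  then obtain z0 r where r: "strict_mono r" "(z \<circ> r) \<longlonglongrightarrow> z0"
    using bounded_imp_convergent_subsequence by blast
  have sr: "(s \<circ> r) \<longlonglongrightarrow> t"
    using LIMSEQ_subseq_LIMSEQ[OF \<open>s \<longlonglongrightarrow> t\<close> r(1)] .
  have z0: "z0 \<in> zero_level w t"
    using t s(1) z(1) r(2) sr by (intro zero_level_limit[OF cont, of t "s \<circ> r" "z \<circ> r"]) auto
  have "(\<lambda>n. dist x ((z \<circ> r) n)) \<longlonglongrightarrow> dist x z0"
    by (intro tendsto_intros r)
  moreover have "(\<lambda>n. dist x ((z \<circ> r) n)) \<longlonglongrightarrow> level_dist w (x, t)"
    using LIMSEQ_subseq_LIMSEQ[OF lim r(1)] z(2) by (simp add: o_def)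
  ultimately have "level_dist w (x, t) = dist x z0"
    by (rule LIMSEQ_unique[symmetric])
  then have "z0 \<in> nearest_points w t x"
    using z0 by (simp add: nearest_points_def dist_norm)
  moreover have "z0 \<notin> extinction_points T w t"
  proof
    assume "z0 \<in> extinction_points T w t"
    then obtain \<epsilon> \<delta> where "\<epsilon> > 0" "\<delta> > 0"
      and ext: "cball z0 \<epsilon> \<times> {t<..t + \<delta>} \<subseteq> positive_region T w"
      by (auto simp: extinction_points_def)
    \<comment> \<open>For large \<open>n\<close> the zero \<open>z (r n)\<close> at time
      \<open>s (r n) > t\<close> would lie in the cylinder on which \<open>w\<close> is
      positive.\<close>
    have "\<forall>\<^sub>F n in sequentially. dist ((z \<circ> r) n) z0 < \<epsilon>"
      using r(2) \<open>\<epsilon> > 0\<close> by (rule tendstoD)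
    moreover have "\<forall>\<^sub>F n in sequentially. (s \<circ> r) n < t + \<delta>"
      using \<open>\<delta> > 0\<close> by (intro order_tendstoD(2)[OF sr]) simp
    ultimately have "\<forall>\<^sub>F n::nat in sequentially. False"
    proof eventually_elim
      case (elim n)
      then have "(z (r n), s (r n)) \<in> positive_region T w"
        using s(2)[of "r n"] by (intro subsetD[OF ext]) (auto simp: dist_commute)
      then show ?case
        using z(1)[of "r n"] by (simp add: positive_region_def zero_level_def)
    qed
    then show False
      by simp
  qed
  ultimately show ?thesis
    by blast
qed

section \<open>Assembly of the three claims\<close>

theorem theorem5p4:
  fixes T L1 L2 :: real
    and u0 :: "real ^ 'n \<Rightarrow> real"
    and H1 :: "real ^ 'n \<Rightarrow> real \<Rightarrow> real ^ 'n \<Rightarrow> real"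
    and w :: "(real ^ 'n) \<times> real \<Rightarrow> real"
  assumes "T > 0"
    and "\<exists>L. L-lipschitz_on UNIV u0"
    and "continuous_on (UNIV \<times> {0..T} \<times> UNIV) (\<lambda>(x, t, p). H1 x t p)"
    and "\<And>x t p r. t \<in> {0..T} \<Longrightarrow> r > 0 \<Longrightarrow> H1 x t (r *\<^sub>R p) = r * H1 x t p"
    and "L1 > 0"
    and "\<And>x y t p. t \<in> {0..T} \<Longrightarrow> norm p = 1 \<Longrightarrow> \<bar>H1 x t p - H1 y t p\<bar> \<le> L1 * norm (x - y)"
    and "L2 > 0"
    and "\<And>x t p q. t \<in> {0..T} \<Longrightarrow> \<bar>H1 x t p - H1 x t q\<bar> \<le> L2 * norm (p - q)"
    and "bdd_above {\<bar>H1 x t p\<bar> | x t p. t \<in> {0..T} \<and> norm p = 1}"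
    and "viscosity_solution_ivp T H1 u0 w"
    and "\<And>x t. t \<in> {0..<T} \<Longrightarrow> w (x, t) \<ge> 0"
    and "\<And>t. t \<in> {0..<T} \<Longrightarrow> zero_level w t \<noteq> {}"
  shows "lower_semicontinuous_on (slab T) (level_dist w) \<and>
    (\<forall>(x, t)\<in>slab T.
      (level_dist w \<longlongrightarrow> level_dist w (x, t)) (at (x, t) within {(y, s)\<in>slab T. s \<le> t})) \<and>
    (\<forall>(x, t)\<in>slab T.
      continuous (at (x, t) within slab T) (level_dist w) \<longleftrightarrow>
      nearest_points w t x - extinction_points T w t \<noteq> {})"
proof -
  have super: "viscosity_supersolution T H1 w" and cont: "continuous_on (UNIV \<times> {0..<T}) w"
    using assms(10) by (auto simp: viscosity_solution_ivp_def viscosity_solution_def)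
  note nonneg = assms(11) and nonempty = assms(12)
  obtain M0 where M0: "\<And>x t p. t \<in> {0..T} \<Longrightarrow> norm p = 1 \<Longrightarrow> \<bar>H1 x t p\<bar> \<le> M0"
    using assms(9) unfolding bdd_above_def by blast
  \<comment> \<open>The maximum with zero supplies the sign condition of the barrier
    argument.\<close>
  define M where "M = max M0 0"
  have "M \<ge> 0"
    by (simp add: M_def)
  have bound: "\<bar>H1 x t p\<bar> \<le> M * norm p" if "t \<in> {0..T}" for x t p
    using M0[OF that] assms(4)[OF that]
    by (intro positively_homogeneous_bounded[where h = "H1 x t"]) (auto simp: M_def le_max_iff_disj)
  have backward: "\<exists>\<eta>>0. \<forall>s t z. 0 \<le> s \<and> s \<le> t \<and> t < s + \<eta> \<and> t \<le> t0 \<and> z \<in> zero_level w t \<longrightarrow>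
    (\<exists>y \<in> zero_level w s. dist z y \<le> \<epsilon>)"
    if "\<epsilon> > 0" "t0 < T" for \<epsilon> t0
    by (rule zero_level_backward[OF super cont nonneg bound \<open>M \<ge> 0\<close> that])

  have past: "(level_dist w \<longlongrightarrow> level_dist w (x, t)) (at (x, t) within {(y, s)\<in>slab T. s \<le> t})"
    if t: "t \<in> {0<..<T}" for x t
  proof -
    obtain z where z: "z \<in> nearest_points w t x"
      using nearest_points_nonempty[OF cont _ nonempty, of t x] t by auto
    show ?thesis
    proof (rule level_dist_tendsto[OF cont nonempty t z])
      fix \<epsilon> :: real
      assume "\<epsilon> > 0"
      \<comment> \<open>Here \<open>t0 = t\<close> suffices: only zeros at time \<open>t\<close> are
        followed backwards, so any nearest point works, extinction point or not.\<close>
      from t have "t < T" by simp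
      obtain \<eta> where \<eta>: "\<eta> > 0"
        "\<And>s t' z. \<lbrakk>0 \<le> s; s \<le> t'; t' < s + \<eta>; t' \<le> t; z \<in> zero_level w t'\<rbrakk>
          \<Longrightarrow> \<exists>y \<in> zero_level w s. dist z y \<le> \<epsilon>"
        using backward[OF \<open>\<epsilon> > 0\<close> \<open>t < T\<close>] by blast
      have "dist s t < \<eta>" if "dist (y, s) (x, t) < \<eta>" for y s
        using that dist_snd_le[of "(y, s)" "(x, t)"] by simp
      then show "\<forall>\<^sub>F (y, s) in at (x, t) within {(y, s)\<in>slab T. s \<le> t}.
          \<exists>z' \<in> zero_level w s. dist z z' \<le> \<epsilon>"
        unfolding eventually_at
        using \<eta>(1) z
        by (intro exI[of _ \<eta>])
          (fastforce simp: slab_def dist_real_def nearest_points_def intro!: \<eta>(2)[of _ t])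
    qed auto
  qed

  have future: "continuous (at (x, t) within slab T) (level_dist w)"
    if t: "t \<in> {0<..<T}" and z: "z \<in> nearest_points w t x" "z \<notin> extinction_points T w t" for x t z
    unfolding continuous_within
  proof (rule level_dist_tendsto[OF cont nonempty t z(1)])
    fix \<epsilon> :: real
    assume "\<epsilon> > 0"
    \<comment> \<open>One half bounds the distance from \<open>z\<close> to a later zero
      \<open>y1\<close>, the other the drift when \<open>y1\<close> is followed backwards.\<close>
    then have "\<epsilon> / 2 > 0" by simp
    define t0 where "t0 = (t + T) / 2"
    have t0: "t < t0" "t0 < T"
      using t by (auto simp: t0_def)
    obtain \<eta> where \<eta>: "\<eta> > 0"
      "\<And>s t' z. \<lbrakk>0 \<le> s; s \<le> t'; t' < s + \<eta>; t' \<le> t0; z \<in> zero_level w t'\<rbrakk>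
        \<Longrightarrow> \<exists>y \<in> zero_level w s. dist z y \<le> \<epsilon> / 2"
      using backward[OF \<open>\<epsilon> / 2 > 0\<close> \<open>t0 < T\<close>] by blast
    \<comment> \<open>Halving \<open>\<eta>\<close> yields the strict
      \<open>s1 < t + \<eta>\<close>; the second bound yields \<open>s1 \<le> t0\<close>.\<close>
    define \<delta> where "\<delta> = min (\<eta> / 2) (t0 - t)"
    have "\<delta> > 0"
      using \<eta>(1) t0 by (simp add: \<delta>_def)
    have z0: "z \<in> zero_level w t"
      using z(1) by (simp add: nearest_points_def)
    \<comment> \<open>Failure of extinction for this particular radius and duration produces a zero
      at a single later time \<open>s1\<close>.\<close>
    with z(2) \<open>\<epsilon> / 2 > 0\<close> \<open>\<delta> > 0\<close>
    have "\<not> cball z (\<epsilon> / 2) \<times> {t<..t + \<delta>} \<subseteq> positive_region T w"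
      unfolding extinction_points_def by blast
    then obtain y1 s1 where y1: "dist z y1 \<le> \<epsilon> / 2" and s1: "t < s1" "s1 \<le> t + \<delta>"
      and notpos: "(y1, s1) \<notin> positive_region T w"
      unfolding subset_iff mem_Times_iff
      by (metis fst_conv greaterThanAtMost_iff mem_cball prod.collapse snd_conv)
    have "s1 \<le> t0" "s1 < t + \<eta>"
      using s1 \<eta>(1) by (auto simp: \<delta>_def)
    then have y1': "y1 \<in> zero_level w s1"
      using notpos nonneg[of s1 y1] t t0 s1
      by (auto simp: positive_region_def slab_def zero_level_def)
    \<comment> \<open>Times up to \<open>t\<close> are reached backwards from \<open>z\<close>,
      times between \<open>t\<close> and \<open>s1\<close> backwards from \<open>y1\<close>;
      together they cover a neighbourhood of \<open>t\<close>.\<close>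
    have near: "\<exists>z' \<in> zero_level w s. dist z z' \<le> \<epsilon>"
      if s: "0 < s" "t - \<eta> < s" "s < s1" for s
    proof (cases "s \<le> t")
      case True
      then show ?thesis
        using \<eta>(2)[of s t z] s t0 z0 \<open>\<epsilon> > 0\<close> by force
    next
      case False
      then obtain z' where "z' \<in> zero_level w s" "dist y1 z' \<le> \<epsilon> / 2"
        using \<eta>(2)[of s s1 y1] s y1' \<open>s1 \<le> t0\<close> \<open>s1 < t + \<eta>\<close> by force
      moreover have "dist z z' \<le> dist z y1 + dist y1 z'"
        by (rule dist_triangle)
      ultimately show ?thesis
        using y1 by (intro bexI[of _ z']) auto
    qed
    have "dist s t < min \<eta> (s1 - t)" if "dist (y, s) (x, t) < min \<eta> (s1 - t)" for y s
      using that dist_snd_le[of "(y, s)" "(x, t)"] by simp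
    then show "\<forall>\<^sub>F (y, s) in at (x, t) within slab T. \<exists>z' \<in> zero_level w s. dist z z' \<le> \<epsilon>"
      unfolding eventually_at
      using \<eta>(1) s1(1)
      by (intro exI[of _ "min \<eta> (s1 - t)"])
        (fastforce simp: slab_def dist_real_def intro!: near)
  qed auto

  show ?thesis
  proof (intro conjI)
    show "lower_semicontinuous_on (slab T) (level_dist w)"
      by (rule lower_semicontinuous_on_level_dist[OF cont nonempty])
    show "\<forall>(x, t)\<in>slab T.
        (level_dist w \<longlongrightarrow> level_dist w (x, t)) (at (x, t) within {(y, s)\<in>slab T. s \<le> t})"
      using past by (auto simp: slab_def)
    show "\<forall>(x, t)\<in>slab T. continuous (at (x, t) within slab T) (level_dist w) \<longleftrightarrow>
        nearest_points w t x - extinction_points T w t \<noteq> {}"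
      using nearest_point_not_extinction_point[OF cont nonempty] future by (force simp: slab_def)
  qed
qed

end
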